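(* Let $\mathbb{K}$ be the field of Puiseux series over a field $k$ and let $f=\sum_{\alpha\in A}a_\alpha(t)z^\alpha\in\mathbb{K}[z_1,\dots,z_n]$ be a nonzero maximally sparse polynomial. Let $V=\{z\in(\mathbb{K}^* )^n: f(z)=0\}$. Then the non-archimedean amoeba $\mathcal{A}(V)\subset\mathbb{R}^n$ is solid.
   Context: $k$ is an arbitrary field. The field $\mathbb{K}$ of Puiseux series consists of the series $a(t)=\sum_{q\in A_a}\xi_q t^{q}$ with $\xi_q\in k\setminus\{0\}$ and $A_a\subset\mathbb{Q}$ well ordered; the valuation is $\mathrm{val}(a)=\min A_a$ for $a\ne0$ and $\mathrm{val}(0)=\infty$. The (non-archimedean) amoeba $\mathcal{A}(V)$ of $V\subset(\mathbb{K}^* )^n$ is the closure in $\mathbb{R}^n$ of the image of $V$ under $(z_1,\dots,z_n)\mapsto(-\mathrm{val}(z_1),\dots,-\mathrm{val}(z_n))$. The Newton polytope of a polynomial is the convex hull in $\mathbb{R}^n$ of the exponents of its monomials with nonzero coefficient; a polynomial is maximally sparse if the only monomials occurring with nonzero coefficients are those corresponding to vertices of its Newton polytope. The recession cone of a set $E\subset\mathbb{R}^n$ is the maximal cone among the (convex) cones that can be placed inside $E$ by a translation; $E$ has full-dimensional recession cone if some translate of an $n$-dimensional convex cone is contained in $E$. A non-archimedean amoeba is called solid if every connected component of its complement in $\mathbb{R}^n$ has full-dimensional recession cone. *)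

theory Defs
  imports "HOL-Analysis.Analysis" "HOL-Library.Poly_Mapping"
begin

section \<open>Well-ordered sets\<close>

definition well_ordered :: "'a::linorder set \<Rightarrow> bool" where
  "well_ordered A \<longleftrightarrow> (\<forall>B\<subseteq>A. B \<noteq> {} \<longrightarrow> (\<exists>m\<in>B. \<forall>b\<in>B. m \<le> b))"

lemma well_ordered_subset: "well_ordered A \<Longrightarrow> B \<subseteq> A \<Longrightarrow> well_ordered B"
  unfolding well_ordered_def by blast

lemma well_orderedE:
  assumes "well_ordered A" "B \<subseteq> A" "B \<noteq> {}"
  obtains m where "m \<in> B" "\<And>b. b \<in> B \<Longrightarrow> m \<le> b"
proof -
  have "\<exists>m\<in>B. \<forall>b\<in>B. m \<le> b"
    using assms(1)[unfolded well_ordered_def, rule_format, OF assms(2,3)] .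
  then show ?thesis using that by auto
qed

lemma well_ordered_finite: "finite A \<Longrightarrow> well_ordered A"
  unfolding well_ordered_def
proof (intro allI impI)
  fix B assume "finite A" "B \<subseteq> A" "B \<noteq> {}"
  then have "finite B" using finite_subset by blast
  then show "\<exists>m\<in>B. \<forall>b\<in>B. m \<le> b"
    using \<open>B \<noteq> {}\<close> by (intro bexI[of _ "Min B"]) auto
qed

lemma well_ordered_Un:
  assumes A: "well_ordered A" and B: "well_ordered B"
  shows "well_ordered (A \<union> B)"
  unfolding well_ordered_def
proof (intro allI impI)
  fix C assume C: "C \<subseteq> A \<union> B" "C \<noteq> {}"
  show "\<exists>m\<in>C. \<forall>b\<in>C. m \<le> b"
  proof (cases "C \<inter> A = {} \<or> C \<inter> B = {}")
    case True
    then have "C \<subseteq> A \<or> C \<subseteq> B" using C by blast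
    then show ?thesis
    proof
      assume "C \<subseteq> A"
      then show ?thesis using A C(2) by (auto simp: well_ordered_def)
    next
      assume "C \<subseteq> B"
      then show ?thesis using B C(2) by (auto simp: well_ordered_def)
    qed
  next
    case False
    obtain x where x: "x \<in> C \<inter> A" "\<And>b. b \<in> C \<inter> A \<Longrightarrow> x \<le> b"
      by (rule well_orderedE[OF A, of "C \<inter> A"]) (use False in auto)
    obtain y where y: "y \<in> C \<inter> B" "\<And>b. b \<in> C \<inter> B \<Longrightarrow> y \<le> b"
      by (rule well_orderedE[OF B, of "C \<inter> B"]) (use False in auto)
    have "min x y \<in> C" using x y by (auto simp: min_def)
    moreover have "\<forall>b\<in>C. min x y \<le> b"
    proof
      fix b assume "b \<in> C"
      then have "b \<in> C \<inter> A \<or> b \<in> C \<inter> B" using C(1) by blast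
      then show "min x y \<le> b" using x(2)[of b] y(2)[of b] by (auto simp: min_le_iff_disj)
    qed
    ultimately show ?thesis by blast
  qed
qed

lemma finite_if_min_max:
  fixes P :: "'a::linorder set"
  assumes P: "well_ordered P"
    and mx: "\<And>Q. Q \<subseteq> P \<Longrightarrow> Q \<noteq> {} \<Longrightarrow> \<exists>m\<in>Q. \<forall>b\<in>Q. b \<le> m"
  shows "finite P"
proof (rule ccontr)
  assume inf: "infinite P"
  define F where "F = {p\<in>P. infinite {x\<in>P. x \<le> p}}"
  obtain M where M: "M \<in> P" "\<forall>b\<in>P. b \<le> M" using mx[of P] inf by auto
  have "{x\<in>P. x \<le> M} = P" using M by auto
  then have "M \<in> F" using inf M by (simp add: F_def)
  have "F \<subseteq> P" "F \<noteq> {}" using \<open>M \<in> F\<close> by (auto simp: F_def)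
  then obtain m where m: "m \<in> F" "\<And>b. b \<in> F \<Longrightarrow> m \<le> b"
    by (rule well_orderedE[OF P]) blast
  have "{x\<in>P. x \<le> m} \<subseteq> insert m {x\<in>P. x < m}" by auto
  then have i: "infinite {x\<in>P. x < m}"
    using m(1) finite_subset[of "{x\<in>P. x \<le> m}" "insert m {x\<in>P. x < m}"]
    by (auto simp: F_def)
  then have "{x\<in>P. x < m} \<noteq> {}" by (metis finite.emptyI)
  then obtain m' where m': "m' \<in> {x\<in>P. x < m}" "\<forall>b\<in>{x\<in>P. x < m}. b \<le> m'"
    using mx[of "{x\<in>P. x < m}"] by blast
  have "{x\<in>P. x \<le> m'} = {x\<in>P. x < m}" using m' by auto
  then have "m' \<in> F" using i m' by (auto simp: F_def)
  then show False using m(2)[of m'] m' by auto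
qed

lemma finite_if_anti:
  fixes P :: "'a::linorder set" and g :: "'a \<Rightarrow> 'b::linorder"
  assumes P: "well_ordered P" and B: "well_ordered B" and g: "g ` P \<subseteq> B"
    and anti: "\<And>x y. x \<in> P \<Longrightarrow> y \<in> P \<Longrightarrow> x < y \<Longrightarrow> g y < g x"
  shows "finite P"
proof (rule finite_if_min_max[OF P])
  fix Q assume Q: "Q \<subseteq> P" "Q \<noteq> {}"
  have "g ` Q \<subseteq> B" "g ` Q \<noteq> {}" using Q g by auto
  then obtain y where y: "y \<in> g ` Q" "\<And>b. b \<in> g ` Q \<Longrightarrow> y \<le> b"
    by (rule well_orderedE[OF B]) blast
  then obtain m where m: "m \<in> Q" "\<And>b. b \<in> g ` Q \<Longrightarrow> g m \<le> b" by blast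
  have "\<forall>b\<in>Q. b \<le> m"
  proof
    fix b assume "b \<in> Q"
    then show "b \<le> m" using m anti[of m b] Q by (metis imageI leD leI subsetD)
  qed
  then show "\<exists>m\<in>Q. \<forall>b\<in>Q. b \<le> m" using m by blast
qed

lemma finite_sum_pairs:
  fixes A B :: "'a::linordered_ab_group_add set"
  assumes A: "well_ordered A" and B: "well_ordered B"
  shows "finite {(p, r). p \<in> A \<and> r \<in> B \<and> p + r = q}"
proof -
  let ?P = "{p\<in>A. q - p \<in> B}"
  have "finite ?P"
    by (rule finite_if_anti[where g = "\<lambda>p. q - p" and B = B])
      (use B in \<open>auto intro: well_ordered_subset[OF A]\<close>)
  moreover have "{(p, r). p \<in> A \<and> r \<in> B \<and> p + r = q} \<subseteq> (\<lambda>p. (p, q - p)) ` ?P"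
    by (auto simp: image_iff)
  ultimately show ?thesis by (meson finite_imageI finite_subset)
qed

lemma well_ordered_sumset:
  fixes A B :: "'a::linordered_ab_group_add set"
  assumes A: "well_ordered A" and B: "well_ordered B"
  shows "well_ordered {p + r | p r. p \<in> A \<and> r \<in> B}"
  unfolding well_ordered_def
proof (intro allI impI)
  fix C assume C: "C \<subseteq> {p + r | p r. p \<in> A \<and> r \<in> B}" "C \<noteq> {}"
  define A0 where "A0 = {p\<in>A. \<exists>r\<in>B. p + r \<in> C}"
  have "\<exists>r. r \<in> B \<and> p + r \<in> C \<and> (\<forall>r'\<in>B. p + r' \<in> C \<longrightarrow> r \<le> r')" if "p \<in> A0" for p
  proof -
    have "{r\<in>B. p + r \<in> C} \<subseteq> B" "{r\<in>B. p + r \<in> C} \<noteq> {}" using that by (auto simp: A0_def)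
    then obtain r where "r \<in> {r\<in>B. p + r \<in> C}" "\<And>r'. r' \<in> {r\<in>B. p + r \<in> C} \<Longrightarrow> r \<le> r'"
      by (rule well_orderedE[OF B]) blast
    then show ?thesis by blast
  qed
  then obtain g where g: "\<And>p. p \<in> A0 \<Longrightarrow> g p \<in> B \<and> p + g p \<in> C \<and> (\<forall>r'\<in>B. p + r' \<in> C \<longrightarrow> g p \<le> r')"
    by metis
  define A1 where "A1 = {p\<in>A0. \<forall>p'\<in>A0. p' < p \<longrightarrow> g p < g p'}"
  have A0A: "A0 \<subseteq> A" by (auto simp: A0_def)
  have fin: "finite A1"
    by (rule finite_if_anti[where g = g and B = B])
      (use A0A g B in \<open>auto simp: A1_def intro: well_ordered_subset[OF A]\<close>)
  have red: "\<exists>p1\<in>A1. p1 + g p1 \<le> c" if "c \<in> C" for c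
  proof -
    obtain p r where pr: "p \<in> A" "r \<in> B" "c = p + r" using C \<open>c \<in> C\<close> by blast
    then have p: "p \<in> A0" "g p \<le> r" using g \<open>c \<in> C\<close> by (auto simp: A0_def)
    let ?S = "{x\<in>A0. x \<le> p \<and> g x \<le> g p}"
    have "?S \<subseteq> A" "?S \<noteq> {}" using p A0A by auto
    then obtain m where m: "m \<in> ?S" "\<And>b. b \<in> ?S \<Longrightarrow> m \<le> b"
      by (rule well_orderedE[OF A]) blast
    have "m \<in> A1"
      unfolding A1_def
    proof (intro CollectI conjI ballI impI)
      show "m \<in> A0" using m by simp
      fix p' assume p': "p' \<in> A0" "p' < m"
      show "g m < g p'"
      proof (rule ccontr)
        assume "\<not> g m < g p'"
        then have "p' \<in> ?S" using p' m(1) by auto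
        then show False using m(2) p'(2) by (meson leD)
      qed
    qed
    moreover have "m + g m \<le> p + r" using m(1) p(2) by (intro add_mono) auto
    ultimately show ?thesis using pr by blast
  qed
  let ?F = "(\<lambda>p. p + g p) ` A1"
  have "A1 \<noteq> {}" using red C(2) by blast
  then have "Min ?F \<in> ?F" using fin by (intro Min_in) auto
  then have "Min ?F \<in> C" using g unfolding A1_def by auto
  moreover have "\<forall>c\<in>C. Min ?F \<le> c"
  proof
    fix c assume "c \<in> C"
    then obtain p1 where "p1 \<in> A1" "p1 + g p1 \<le> c" using red by blast
    then show "Min ?F \<le> c" using fin by (meson Min_le finite_imageI imageI order_trans)
  qed
  ultimately show "\<exists>m\<in>C. \<forall>b\<in>C. m \<le> b" by blast
qed

section \<open>The field of Puiseux series\<close>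

text \<open>The exponents need not have a common denominator: the support is any well-ordered set of
  rationals, so this is the Hahn series field with value group \<open>\<rat>\<close>.\<close>

typedef (overloaded) 'a puiseux = "{f :: rat \<Rightarrow> 'a::zero. well_ordered {q. f q \<noteq> 0}}"
  morphisms pcoeff Abs_puiseux
  by (intro exI[of _ "\<lambda>_. 0"]) (simp add: well_ordered_def)

setup_lifting type_definition_puiseux

definition psupp :: "'a::zero puiseux \<Rightarrow> rat set" where
  "psupp a = {q. pcoeff a q \<noteq> 0}"

lemma well_ordered_psupp: "well_ordered (psupp a)"
  using pcoeff[of a] by (simp add: psupp_def)

lemma puiseux_eqI: "(\<And>q. pcoeff a q = pcoeff b q) \<Longrightarrow> a = b"
  by (simp add: pcoeff_inject[symmetric] fun_eq_iff)

instantiation puiseux :: (comm_ring_1) "{zero, one, plus, minus, uminus, times}"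
begin

lift_definition zero_puiseux :: "'a puiseux" is "\<lambda>_. 0"
  by (simp add: well_ordered_def)

lift_definition one_puiseux :: "'a puiseux" is "\<lambda>q. if q = 0 then 1 else 0"
  by (rule well_ordered_finite) (rule finite_subset[of _ "{0}"], auto)

lift_definition plus_puiseux :: "'a puiseux \<Rightarrow> 'a puiseux \<Rightarrow> 'a puiseux"
  is "\<lambda>f g q. f q + g q"
proof -
  fix f g :: "rat \<Rightarrow> 'a"
  assume "well_ordered {q. f q \<noteq> 0}" "well_ordered {q. g q \<noteq> 0}"
  from well_ordered_Un[OF this] show "well_ordered {q. f q + g q \<noteq> 0}"
    by (rule well_ordered_subset) auto
qed

lift_definition minus_puiseux :: "'a puiseux \<Rightarrow> 'a puiseux \<Rightarrow> 'a puiseux"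
  is "\<lambda>f g q. f q - g q"
proof -
  fix f g :: "rat \<Rightarrow> 'a"
  assume "well_ordered {q. f q \<noteq> 0}" "well_ordered {q. g q \<noteq> 0}"
  from well_ordered_Un[OF this] show "well_ordered {q. f q - g q \<noteq> 0}"
    by (rule well_ordered_subset) auto
qed

lift_definition uminus_puiseux :: "'a puiseux \<Rightarrow> 'a puiseux" is "\<lambda>f q. - f q"
  by simp

lift_definition times_puiseux :: "'a puiseux \<Rightarrow> 'a puiseux \<Rightarrow> 'a puiseux"
  is "\<lambda>f g q. \<Sum>(p, r) | f p \<noteq> 0 \<and> g r \<noteq> 0 \<and> p + r = q. f p * g r"
proof -
  fix f g :: "rat \<Rightarrow> 'a"
  assume "well_ordered {q. f q \<noteq> 0}" "well_ordered {q. g q \<noteq> 0}"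
  from well_ordered_sumset[OF this]
  show "well_ordered {q. (\<Sum>(p, r) | f p \<noteq> 0 \<and> g r \<noteq> 0 \<and> p + r = q. f p * g r) \<noteq> 0}"
  proof (rule well_ordered_subset, safe)
    fix q assume "(\<Sum>(p, r) | f p \<noteq> 0 \<and> g r \<noteq> 0 \<and> p + r = q. f p * g r) \<noteq> 0"
    then have "{(p, r). f p \<noteq> 0 \<and> g r \<noteq> 0 \<and> p + r = q} \<noteq> {}" by (metis sum.empty)
    then show "\<exists>p r. q = p + r \<and> p \<in> {q. f q \<noteq> 0} \<and> r \<in> {q. g q \<noteq> 0}" by auto
  qed
qed

instance ..

end

lemma pcoeff_simps [simp]:
  "pcoeff 0 q = 0"
  "pcoeff 1 q = (if q = 0 then 1 else 0)"
  "pcoeff (a + b) q = pcoeff a q + pcoeff b q"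
  "pcoeff (a - b) q = pcoeff a q - pcoeff b q"
  "pcoeff (- a) q = - pcoeff a q"
  by (transfer; simp)+

lemma pcoeff_times:
  assumes "well_ordered A" "well_ordered B" "psupp a \<subseteq> A" "psupp b \<subseteq> B"
  shows "pcoeff (a * b) q = (\<Sum>(p, r) | p \<in> A \<and> r \<in> B \<and> p + r = q. pcoeff a p * pcoeff b r)"
proof -
  have "pcoeff (a * b) q
      = (\<Sum>(p, r) | pcoeff a p \<noteq> 0 \<and> pcoeff b r \<noteq> 0 \<and> p + r = q. pcoeff a p * pcoeff b r)"
    by transfer simp
  also have "\<dots> = (\<Sum>(p, r) | p \<in> A \<and> r \<in> B \<and> p + r = q. pcoeff a p * pcoeff b r)"
    by (rule sum.mono_neutral_left[OF finite_sum_pairs[OF assms(1,2)]])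
      (use assms(3,4) in \<open>auto simp: psupp_def\<close>)
  finally show ?thesis .
qed

lemmas pcoeff_times' = pcoeff_times[OF well_ordered_psupp well_ordered_psupp order_refl order_refl]

lemma psupp_times: "psupp (a * b) \<subseteq> {p + r | p r. p \<in> psupp a \<and> r \<in> psupp b}"
proof
  fix q assume "q \<in> psupp (a * b)"
  then have "(\<Sum>(p, r) | p \<in> psupp a \<and> r \<in> psupp b \<and> p + r = q. pcoeff a p * pcoeff b r) \<noteq> 0"
    by (simp add: psupp_def[of "a * b"] pcoeff_times')
  then have "{(p, r). p \<in> psupp a \<and> r \<in> psupp b \<and> p + r = q} \<noteq> {}" by (metis sum.empty)
  then show "q \<in> {p + r | p r. p \<in> psupp a \<and> r \<in> psupp b}" by auto
qed

lemma puiseux_mult_commute: "a * b = b * (a :: 'a::comm_ring_1 puiseux)"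
proof (rule puiseux_eqI)
  fix q
  show "pcoeff (a * b) q = pcoeff (b * a) q"
    unfolding pcoeff_times'
    by (rule sum.reindex_bij_witness[of _ prod.swap prod.swap]) (auto simp: mult.commute add.commute)
qed

lemma puiseux_mult_triple:
  fixes a b c :: "'a::comm_ring_1 puiseux"
  shows "pcoeff (a * b * c) q
    = (\<Sum>(p, r, s) | p \<in> psupp a \<and> r \<in> psupp b \<and> s \<in> psupp c \<and> p + r + s = q.
        pcoeff a p * pcoeff b r * pcoeff c s)"
proof -
  let ?D = "{p + r | p r. p \<in> psupp a \<and> r \<in> psupp b}"
  let ?S = "{(u, s). u \<in> ?D \<and> s \<in> psupp c \<and> u + s = q}"
  let ?P = "\<lambda>u. {(p, r). p \<in> psupp a \<and> r \<in> psupp b \<and> p + r = u}"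
  have D: "well_ordered ?D" by (intro well_ordered_sumset well_ordered_psupp)
  have finS: "finite ?S" by (rule finite_sum_pairs[OF D well_ordered_psupp])
  have finP: "finite (?P u)" for u by (intro finite_sum_pairs well_ordered_psupp)
  have "pcoeff (a * b * c) q = (\<Sum>(u, s)\<in>?S. pcoeff (a * b) u * pcoeff c s)"
    by (rule pcoeff_times[OF D well_ordered_psupp psupp_times order_refl])
  also have "\<dots> = (\<Sum>us\<in>?S. \<Sum>pr\<in>?P (fst us). pcoeff a (fst pr) * pcoeff b (snd pr) * pcoeff c (snd us))"
    by (rule sum.cong) (auto simp: pcoeff_times' sum_distrib_right case_prod_unfold)
  also have "\<dots> = (\<Sum>(us, pr)\<in>Sigma ?S (\<lambda>us. ?P (fst us)).
      pcoeff a (fst pr) * pcoeff b (snd pr) * pcoeff c (snd us))"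
    by (rule sum.Sigma) (use finS finP in auto)
  also have "\<dots> = (\<Sum>(p, r, s) | p \<in> psupp a \<and> r \<in> psupp b \<and> s \<in> psupp c \<and> p + r + s = q.
        pcoeff a p * pcoeff b r * pcoeff c s)"
    by (rule sum.reindex_bij_witness[of _ "\<lambda>(p, r, s). ((p + r, s), (p, r))"
          "\<lambda>((u, s), (p, r)). (p, r, s)"]) auto
  finally show ?thesis .
qed

lemma puiseux_mult_assoc: "a * b * c = a * (b * (c :: 'a::comm_ring_1 puiseux))"
proof (rule puiseux_eqI)
  fix q
  have "pcoeff (a * b * c) q = pcoeff (b * c * a) q"
    unfolding puiseux_mult_triple
    by (rule sum.reindex_bij_witness[of _ "\<lambda>(r, s, p). (p, r, s)" "\<lambda>(p, r, s). (r, s, p)"])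
      (auto simp: algebra_simps)
  then show "pcoeff (a * b * c) q = pcoeff (a * (b * c)) q"
    by (simp add: puiseux_mult_commute)
qed

lemma puiseux_distrib: "(a + b) * c = a * c + b * (c :: 'a::comm_ring_1 puiseux)"
proof (rule puiseux_eqI)
  fix q
  let ?A = "psupp a \<union> psupp b"
  have A: "well_ordered ?A" by (intro well_ordered_Un well_ordered_psupp)
  have s: "psupp (a + b) \<subseteq> ?A" by (auto simp: psupp_def)
  show "pcoeff ((a + b) * c) q = pcoeff (a * c + b * c) q"
    unfolding pcoeff_simps pcoeff_times[OF A well_ordered_psupp s order_refl]
      pcoeff_times[OF A well_ordered_psupp Un_upper1 order_refl]
      pcoeff_times[OF A well_ordered_psupp Un_upper2 order_refl]
    by (simp add: sum.distrib[symmetric] case_prod_unfold distrib_right)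
qed

lemma puiseux_mult_one: "1 * a = (a :: 'a::comm_ring_1 puiseux)"
proof (rule puiseux_eqI)
  fix q
  have "pcoeff (1 * a) q = (\<Sum>(p, r) | p \<in> {0} \<and> r \<in> psupp a \<and> p + r = q. pcoeff 1 p * pcoeff a r)"
    by (rule pcoeff_times) (use well_ordered_psupp[of a] in \<open>auto simp: well_ordered_finite psupp_def\<close>)
  also have "\<dots> = (\<Sum>(p, r)\<in>(if q \<in> psupp a then {(0, q)} else {}). pcoeff 1 p * pcoeff a r)"
    by (rule sum.cong) (auto split: if_splits)
  also have "\<dots> = pcoeff a q" by (auto simp: psupp_def)
  finally show "pcoeff (1 * a) q = pcoeff a q" .
qed

instance puiseux :: (comm_ring_1) comm_ring_1
proof
  fix a b c :: "'a puiseux"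
  show "a * b * c = a * (b * c)" by (rule puiseux_mult_assoc)
  show "a * b = b * a" by (rule puiseux_mult_commute)
  show "1 * a = a" by (rule puiseux_mult_one)
  show "(a + b) * c = a * c + b * c" by (rule puiseux_distrib)
  show "(0 :: 'a puiseux) \<noteq> 1"
    by (metis pcoeff_simps(1,2) zero_neq_one)
qed (rule puiseux_eqI; simp)+

text \<open>The rest of the section shows that nonzero series over a field are invertible, by a
  geometric series; its support is well ordered because \<open>\<rat>\<close> is Archimedean.\<close>

definition pbound :: "rat \<Rightarrow> 'a::zero puiseux \<Rightarrow> bool" where
  "pbound s a \<longleftrightarrow> (\<forall>q\<in>psupp a. s \<le> q)"

lemma pbound_times:
  assumes "pbound s a" "pbound t b"
  shows "pbound (s + t) (a * b)"
  using assms psupp_times[of a b] unfolding pbound_def by (fastforce intro: add_mono)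

lemma pbound_less: "pbound s a \<Longrightarrow> q < s \<Longrightarrow> pcoeff a q = 0"
  unfolding pbound_def psupp_def by force

lemma pbound_power: "pbound s a \<Longrightarrow> pbound (of_nat m * s) (a ^ m)"
proof (induction m)
  case 0
  then show ?case by (auto simp: pbound_def psupp_def)
next
  case (Suc m)
  then show ?case using pbound_times[of s a "of_nat m * s" "a ^ m"] by (simp add: algebra_simps)
qed

lemma pcoeff_sum: "pcoeff (\<Sum>x\<in>X. f x) q = (\<Sum>x\<in>X. pcoeff (f x) q)"
  by (induction X rule: infinite_finite_induct) auto

lemma geometric_inverse:
  fixes b :: "'a::comm_ring_1 puiseux"
  assumes s: "0 < s" "pbound s b"
  shows "\<exists>g. (1 - b) * g = 1"
proof -
  define G where "G N = (\<Sum>m<N. b ^ m)" for N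
  have stab: "pcoeff (G M) q = pcoeff (G N) q" if "N \<le> M" "q < of_nat N * s" for N M q
  proof -
    have "pcoeff (b ^ m) q = 0" if m: "m \<in> {..<M} - {..<N}" for m
    proof (rule pbound_less[OF pbound_power[OF s(2)]])
      have "of_nat N * s \<le> of_nat m * s" using m s(1) by (intro mult_right_mono) auto
      then show "q < of_nat m * s" using \<open>q < of_nat N * s\<close> by linarith
    qed
    then show ?thesis
      unfolding G_def pcoeff_sum using \<open>N \<le> M\<close>
      by (intro sum.mono_neutral_right) auto
  qed
  have "\<exists>N::nat. q < of_nat N * s" for q
    using reals_Archimedean3[of s] s(1) ex_less_of_nat_mult[of s q] by auto
  then obtain N where N: "\<And>q. q < of_nat (N q :: nat) * s" by metis
  have cong: "pcoeff (G (N q)) q = pcoeff (G M) q" if "q < of_nat M * s" for q M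
    using stab[of M "N q" q] stab[of "N q" M q] N[of q] that by (metis nle_le)
  define h where "h q = pcoeff (G (N q)) q" for q
  have "well_ordered {q. h q \<noteq> 0}"
    unfolding well_ordered_def
  proof (intro allI impI)
    fix B assume B: "B \<subseteq> {q. h q \<noteq> 0}" "B \<noteq> {}"
    then obtain q0 where q0: "q0 \<in> B" by blast
    let ?B = "{q\<in>B. q \<le> q0}"
    have "?B \<subseteq> psupp (G (N q0))"
    proof
      fix q assume q: "q \<in> ?B"
      then have "q < of_nat (N q0) * s" using N[of q0] by auto
      then have "h q = pcoeff (G (N q0)) q" unfolding h_def by (rule cong)
      then show "q \<in> psupp (G (N q0))" using q B(1) by (auto simp: psupp_def)
    qed
    moreover have "?B \<noteq> {}" using q0 by auto
    ultimately obtain m where m: "m \<in> ?B" "\<And>b. b \<in> ?B \<Longrightarrow> m \<le> b"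
      by (rule well_orderedE[OF well_ordered_psupp]) blast
    have "\<forall>b\<in>B. m \<le> b"
    proof
      fix b assume "b \<in> B"
      then show "m \<le> b" using m by (cases "b \<le> q0") auto
    qed
    then show "\<exists>m\<in>B. \<forall>b\<in>B. m \<le> b" using m by auto
  qed
  then obtain g where g: "\<And>q. pcoeff g q = h q"
    using Abs_puiseux_inverse[of h] by (metis mem_Collect_eq)
  have "pcoeff ((1 - b) * g) q = pcoeff 1 q" for q
  proof -
    let ?M = "N q"
    have p0: "pbound 0 (1 - b)"
      using s unfolding pbound_def psupp_def by (force split: if_splits)
    have "pbound (of_nat ?M * s) (g - G ?M)"
      unfolding pbound_def psupp_def using cong[of _ ?M] g h_def by force
    from pbound_times[OF p0 this] have "pcoeff ((1 - b) * (g - G ?M)) q = 0"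
      using N[of q] by (intro pbound_less) auto
    then have "pcoeff ((1 - b) * g) q = pcoeff ((1 - b) * G ?M) q"
      by (simp add: right_diff_distrib)
    also have "(1 - b) * G ?M = 1 - b ^ ?M"
      unfolding G_def by (rule one_diff_power_eq[symmetric])
    also have "pcoeff (1 - b ^ ?M) q = pcoeff 1 q"
      using pbound_less[OF pbound_power[OF s(2)] N[of q]] by simp
    finally show ?thesis .
  qed
  then show ?thesis by (intro exI puiseux_eqI)
qed

lift_definition pmonom :: "'a::zero \<Rightarrow> rat \<Rightarrow> 'a puiseux" is "\<lambda>c v q. if q = v then c else 0"
  by (rule well_ordered_finite) (rule finite_subset, auto)

lemma pcoeff_pmonom [simp]: "pcoeff (pmonom c v) q = (if q = v then c else 0)"
  by transfer simp

lemma pcoeff_times_pmonom: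
  "pcoeff (a * pmonom c v) q = pcoeff a (q - v) * (c :: 'a::comm_ring_1)"
proof -
  have "pcoeff (a * pmonom c v) q
      = (\<Sum>(p, r) | p \<in> psupp a \<and> r \<in> {v} \<and> p + r = q. pcoeff a p * pcoeff (pmonom c v) r)"
    by (rule pcoeff_times) (use well_ordered_psupp[of a] in \<open>auto simp: well_ordered_finite psupp_def split: if_splits\<close>)
  also have "\<dots> = (\<Sum>(p, r)\<in>(if q - v \<in> psupp a then {(q - v, v)} else {}). pcoeff a p * pcoeff (pmonom c v) r)"
    by (rule sum.cong) (auto split: if_splits)
  also have "\<dots> = pcoeff a (q - v) * c" by (auto simp: psupp_def)
  finally show ?thesis .
qed

lemma puiseux_inverse_exists:
  fixes a :: "'a::field puiseux"
  assumes "a \<noteq> 0"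
  shows "\<exists>b. a * b = 1"
proof -
  have "psupp a \<noteq> {}" using assms puiseux_eqI[of a 0] by (auto simp: psupp_def)
  then obtain v where v: "v \<in> psupp a" "\<And>q. q \<in> psupp a \<Longrightarrow> v \<le> q"
    by (rule well_orderedE[OF well_ordered_psupp order_refl]) blast
  define u where "u = pmonom (1 / pcoeff a v) (- v)"
  define b where "b = 1 - a * u"
  have cb: "pcoeff b q = (if q = 0 then 0 else - (pcoeff a (q + v) / pcoeff a v))" for q
    using v(1) by (simp add: b_def u_def pcoeff_times_pmonom psupp_def)
  have pos: "0 < q" if "q \<in> psupp b" for q
    using that v(2)[of "q + v"] by (auto simp: psupp_def cb split: if_splits)
  have "\<exists>s>0. pbound s b"
  proof (cases "psupp b = {}")
    case True
    then show ?thesis by (intro exI[of _ 1]) (simp add: pbound_def)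
  next
    case False
    then obtain m where "m \<in> psupp b" "\<And>q. q \<in> psupp b \<Longrightarrow> m \<le> q"
      by (rule well_orderedE[OF well_ordered_psupp order_refl]) blast
    then show ?thesis using pos unfolding pbound_def by blast
  qed
  then obtain g where "(1 - b) * g = 1" using geometric_inverse by blast
  then have "a * (u * g) = 1" by (simp add: b_def mult.assoc)
  then show ?thesis by blast
qed

instantiation puiseux :: (field) field
begin

definition inverse_puiseux :: "'a puiseux \<Rightarrow> 'a puiseux" where
  "inverse a = (if a = 0 then 0 else (THE b. a * b = (1 :: 'a puiseux)))"

definition divide_puiseux :: "'a puiseux \<Rightarrow> 'a puiseux \<Rightarrow> 'a puiseux" where
  "a div b = a * inverse (b :: 'a puiseux)"

instance
proof
  fix a b :: "'a puiseux"
  show "inverse a * a = 1" if "a \<noteq> 0"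
  proof -
    obtain c where c: "a * c = 1" using puiseux_inverse_exists[OF \<open>a \<noteq> 0\<close>] by blast
    have "(THE b. a * b = 1) = c"
    proof (rule the_equality)
      show "a * c = 1" by (rule c)
    next
      fix d assume "a * d = 1"
      then have "d = d * (a * c)" using c by simp
      also have "\<dots> = (a * d) * c" by (simp add: ac_simps)
      finally show "d = c" using \<open>a * d = 1\<close> by simp
    qed
    then show ?thesis using c that by (simp add: inverse_puiseux_def mult.commute)
  qed
  show "a div b = a * inverse b" by (rule divide_puiseux_def)
  show "inverse (0 :: 'a puiseux) = 0" by (simp add: inverse_puiseux_def)
qed

end

text \<open>For nonzero \<open>a\<close> the least element exists since the support is well ordered.\<close>

definition pval :: "'a::field puiseux \<Rightarrow> ereal" where
  "pval a = (if a = 0 then \<infinity> else ereal (of_rat (LEAST q. q \<in> psupp a)))"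

section \<open>Polynomials, hypersurfaces and Newton polytopes\<close>

text \<open>A polynomial in variables indexed by \<open>'n\<close> is a finitely supported family of coefficients,
  indexed by exponent vectors.\<close>

type_synonym ('n, 'r) mpolynomial = "('n \<Rightarrow>\<^sub>0 nat) \<Rightarrow>\<^sub>0 'r"

definition mpoly_eval :: "('n::finite, 'r::comm_ring_1) mpolynomial \<Rightarrow> 'r ^ 'n \<Rightarrow> 'r" where
  "mpoly_eval f z =
    (\<Sum>\<alpha>\<in>Poly_Mapping.keys f.
      Poly_Mapping.lookup f \<alpha> * (\<Prod>i\<in>UNIV. (z $ i) ^ Poly_Mapping.lookup \<alpha> i))"

definition torus_zeros :: "('n::finite, 'r::field) mpolynomial \<Rightarrow> ('r ^ 'n) set" where
  "torus_zeros f = {z. (\<forall>i. z $ i \<noteq> 0) \<and> mpoly_eval f z = 0}"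

definition exponent_point :: "('n::finite \<Rightarrow>\<^sub>0 nat) \<Rightarrow> real ^ 'n" where
  "exponent_point \<alpha> = (\<chi> i. real (Poly_Mapping.lookup \<alpha> i))"

definition newton_polytope :: "('n::finite, 'r::zero) mpolynomial \<Rightarrow> (real ^ 'n) set" where
  "newton_polytope f = convex hull (exponent_point ` Poly_Mapping.keys f)"

definition maximally_sparse :: "('n::finite, 'r::zero) mpolynomial \<Rightarrow> bool" where
  "maximally_sparse f \<longleftrightarrow>
    (\<forall>\<alpha>\<in>Poly_Mapping.keys f. exponent_point \<alpha> extreme_point_of newton_polytope f)"

section \<open>Non-archimedean amoebas\<close>

text \<open>On the torus all valuations are finite, so \<open>real_of_ereal\<close> loses nothing there.\<close>

definition amoeba :: "('k::field puiseux ^ 'n::finite) set \<Rightarrow> (real ^ 'n) set" where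
  "amoeba V = closure ((\<lambda>z. \<chi> i. - real_of_ereal (pval (z $ i))) ` V)"

definition full_dim_recession_cone :: "(real ^ 'n::finite) set \<Rightarrow> bool" where
  "full_dim_recession_cone E \<longleftrightarrow>
    (\<exists>K v. cone K \<and> convex K \<and> aff_dim K = int CARD('n) \<and> (+) v ` K \<subseteq> E)"

definition solid :: "(real ^ 'n::finite) set \<Rightarrow> bool" where
  "solid S \<longleftrightarrow> (\<forall>E\<in>components (- S). full_dim_recession_cone E)"

end

theory Submission
  imports Defs
begin

text \<open>Where a single monomial strictly dominates the tropical polynomial of \<open>f\<close>, the
  ultrametric inequality forbids zeros of \<open>f\<close>, so the amoeba misses the (open, convex) dominance
  region of every monomial. These regions are dense, their complement being contained in finitely
  many hyperplanes; hence every complement component contains one of them. The dominance region of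
  a monomial is invariant under translation by the normal cone of the Newton polytope at its
  exponent, and this cone is full-dimensional when the exponent is a vertex. Only this easy half of
  Kapranov's theorem is used, so \<open>k\<close> need not be algebraically closed.\<close>

text \<open>A relational form of the finite valuation: it keeps exponents in \<open>rat\<close>, so
  that they add without passing through \<open>ereal\<close> or \<open>LEAST\<close>. The zero
  series is related to no value.\<close>

definition has_val :: "'a::zero puiseux \<Rightarrow> rat \<Rightarrow> bool" where
  "has_val a v \<longleftrightarrow> pcoeff a v \<noteq> 0 \<and> pbound v a"

lemma has_val_ex:
  assumes "a \<noteq> (0 :: 'a::comm_ring_1 puiseux)"
  obtains v where "has_val a v"
proof -
  have "psupp a \<noteq> {}" using assms puiseux_eqI[of a 0] by (auto simp: psupp_def)
  then obtain v where "v \<in> psupp a" "\<And>q. q \<in> psupp a \<Longrightarrow> v \<le> q"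
    by (rule well_orderedE[OF well_ordered_psupp order_refl]) blast
  then have "has_val a v" by (auto simp: has_val_def pbound_def psupp_def)
  then show thesis by (rule that)
qed

lemma pval_eq_if_has_val:
  fixes a :: "'a::field puiseux"
  assumes "has_val a v"
  shows "pval a = ereal (of_rat v)"
proof -
  have "a \<noteq> 0" using assms by (auto simp: has_val_def)
  moreover have "(LEAST q. q \<in> psupp a) = v"
    using assms by (intro Least_equality) (auto simp: has_val_def pbound_def psupp_def)
  ultimately show ?thesis by (simp add: pval_def)
qed

lemma has_val_one: "has_val (1 :: 'a::comm_ring_1 puiseux) 0"
  by (auto simp: has_val_def pbound_def psupp_def)

text \<open>The lowest exponent of the product arises only from the two leading terms, and their
  coefficients multiply to something nonzero because \<open>'a\<close> is a domain.\<close>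

lemma has_val_mult:
  fixes a b :: "'a::idom puiseux"
  assumes "has_val a v" "has_val b w"
  shows "has_val (a * b) (v + w)"
proof -
  have "{(p, r). p \<in> psupp a \<and> r \<in> psupp b \<and> p + r = v + w} = {(v, w)}"
  proof (intro equalityI subsetI)
    fix x assume "x \<in> {(p, r). p \<in> psupp a \<and> r \<in> psupp b \<and> p + r = v + w}"
    then obtain p r where "x = (p, r)" "p \<in> psupp a" "r \<in> psupp b" and eq: "p + r = v + w"
      by auto
    moreover have "v \<le> p" "w \<le> r"
      using assms calculation by (auto simp: has_val_def pbound_def)
    ultimately show "x \<in> {(v, w)}" by auto
  qed (use assms in \<open>auto simp: has_val_def psupp_def\<close>)
  then have "pcoeff (a * b) (v + w) = pcoeff a v * pcoeff b w"
    by (simp add: pcoeff_times')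
  then show ?thesis using assms pbound_times[of v a w b] by (simp add: has_val_def)
qed

lemma has_val_power:
  fixes a :: "'a::idom puiseux"
  assumes "has_val a v"
  shows "has_val (a ^ m) (of_nat m * v)"
proof (induction m)
  case 0
  then show ?case by (simp add: has_val_one)
next
  case (Suc m)
  then show ?case using has_val_mult[OF assms Suc] by (simp add: algebra_simps)
qed

lemma has_val_prod:
  fixes a :: "'i \<Rightarrow> 'a::idom puiseux"
  assumes "\<And>i. i \<in> I \<Longrightarrow> has_val (a i) (v i)"
  shows "has_val (\<Prod>i\<in>I. a i) (\<Sum>i\<in>I. v i)"
  using assms
  by (induction I rule: infinite_finite_induct) (auto simp: has_val_one has_val_mult)

text \<open>At exponent \<open>r \<alpha>\<close> only \<open>t \<alpha>\<close> contributes, so its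
  leading coefficient cannot cancel.\<close>

lemma sum_nonzero_if_unique_min_val:
  fixes t :: "'i \<Rightarrow> 'a::comm_ring_1 puiseux"
  assumes "finite A" "\<alpha> \<in> A" "\<And>\<beta>. \<beta> \<in> A \<Longrightarrow> has_val (t \<beta>) (r \<beta>)"
    and "\<And>\<beta>. \<beta> \<in> A \<Longrightarrow> \<beta> \<noteq> \<alpha> \<Longrightarrow> r \<alpha> < r \<beta>"
  shows "(\<Sum>\<beta>\<in>A. t \<beta>) \<noteq> 0"
proof -
  have "pcoeff (t \<beta>) (r \<alpha>) = 0" if "\<beta> \<in> A - {\<alpha>}" for \<beta>
    using assms(3)[of \<beta>] assms(4)[of \<beta>] that pbound_less[of "r \<beta>" "t \<beta>" "r \<alpha>"]
    by (auto simp: has_val_def)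
  then have "pcoeff (\<Sum>\<beta>\<in>A. t \<beta>) (r \<alpha>) = pcoeff (t \<alpha>) (r \<alpha>)"
    using assms(1,2) by (simp add: pcoeff_sum sum.remove)
  then show ?thesis using assms(3)[OF assms(2)] by (auto simp: has_val_def)
qed

lemma inj_exponent_point: "inj exponent_point"
  by (rule injI, rule poly_mapping_eqI) (simp add: exponent_point_def vec_eq_iff)

text \<open>This is where \<alpha> is the only maximiser of \<beta> \<bullet> x - val(a_\<beta>),
  the terms of the tropical polynomial; each comparison is rearranged into an open
  halfspace.\<close>

definition dominance_region ::
    "('n::finite, 'k::field puiseux) mpolynomial \<Rightarrow> ('n \<Rightarrow>\<^sub>0 nat) \<Rightarrow> (real ^ 'n) set" where
  "dominance_region f \<alpha> = (\<Inter>\<beta>\<in>Poly_Mapping.keys f - {\<alpha>}.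
    {x. (exponent_point \<beta> - exponent_point \<alpha>) \<bullet> x
        < real_of_ereal (pval (Poly_Mapping.lookup f \<beta>))
          - real_of_ereal (pval (Poly_Mapping.lookup f \<alpha>))})"

lemma open_dominance_region: "open (dominance_region f \<alpha>)"
  unfolding dominance_region_def by (intro open_INT ballI open_halfspace_lt) auto

lemma convex_dominance_region: "convex (dominance_region f \<alpha>)"
  unfolding dominance_region_def by (intro convex_INT convex_halfspace_lt)

lemma dominance_region_disjoint_amoeba:
  fixes f :: "('n::finite, 'k::field puiseux) mpolynomial"
  assumes \<alpha>: "\<alpha> \<in> Poly_Mapping.keys f"
  shows "dominance_region f \<alpha> \<inter> amoeba (torus_zeros f) = {}"
proof -
  let ?L = "\<lambda>z :: 'k puiseux ^ 'n. \<chi> i. - real_of_ereal (pval (z $ i))"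
  have "?L z \<notin> dominance_region f \<alpha>" if z: "z \<in> torus_zeros f" for z
  proof
    assume dom: "?L z \<in> dominance_region f \<alpha>"
    have "\<forall>i. \<exists>v. has_val (z $ i) v"
      using z has_val_ex by (metis (mono_tags, lifting) mem_Collect_eq torus_zeros_def)
    then obtain v where v: "\<And>i. has_val (z $ i) (v i)" by metis
    have "\<forall>\<beta>\<in>Poly_Mapping.keys f. \<exists>u. has_val (Poly_Mapping.lookup f \<beta>) u"
      using has_val_ex by (metis in_keys_iff)
    then obtain u where u: "\<And>\<beta>. \<beta> \<in> Poly_Mapping.keys f \<Longrightarrow> has_val (Poly_Mapping.lookup f \<beta>) (u \<beta>)"
      by metis
    define r where "r \<beta> = u \<beta> + (\<Sum>i\<in>UNIV. of_nat (Poly_Mapping.lookup \<beta> i) * v i)"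
      for \<beta> :: "'n \<Rightarrow>\<^sub>0 nat"
    \<comment> \<open>\<open>r \<beta>\<close> is the valuation of the \<beta>-term at z. The
      coordinates of \<open>?L z\<close> are negated valuations, hence the minus sign: a maximal
      tropical term has minimal valuation.\<close>
    have "of_rat (r \<beta>) = of_rat (u \<beta>) - exponent_point \<beta> \<bullet> ?L z" for \<beta>
      by (simp add: r_def of_rat_add of_rat_sum of_rat_mult exponent_point_def inner_vec_def
          pval_eq_if_has_val[OF v] sum_negf)
    moreover have "(exponent_point \<beta> - exponent_point \<alpha>) \<bullet> ?L z < of_rat (u \<beta>) - of_rat (u \<alpha>)"
      if "\<beta> \<in> Poly_Mapping.keys f" "\<beta> \<noteq> \<alpha>" for \<beta>
      using dom that \<alpha> by (auto simp: dominance_region_def pval_eq_if_has_val[OF u])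
    ultimately have "(of_rat (r \<alpha>) :: real) < of_rat (r \<beta>)"
      if "\<beta> \<in> Poly_Mapping.keys f" "\<beta> \<noteq> \<alpha>" for \<beta>
      using that by (fastforce simp: inner_diff_left)
    then have "mpoly_eval f z \<noteq> 0"
      unfolding mpoly_eval_def
      by (intro sum_nonzero_if_unique_min_val[OF _ \<alpha>, where r = r])
        (auto simp: r_def of_rat_less intro!: has_val_mult has_val_prod has_val_power u v)
    then show False using z by (simp add: torus_zeros_def)
  qed
  then have "dominance_region f \<alpha> \<inter> ?L ` torus_zeros f = {}" by auto
  \<comment> \<open>Passing to the closure is harmless, since an open set missing a set also misses
    its closure.\<close>
  then show ?thesis
    unfolding amoeba_def by (simp add: open_Int_closure_eq_empty open_dominance_region)
qed

text \<open>A point with no ties between monomials lies in the region of its maximal monomial, and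
  ties fill only a null set, which cannot contain a nonempty open set.\<close>

lemma open_meets_dominance_region:
  fixes f :: "('n::finite, 'k::field puiseux) mpolynomial"
  assumes "f \<noteq> 0" "open E" "E \<noteq> {}"
  obtains \<alpha> x where "\<alpha> \<in> Poly_Mapping.keys f" "x \<in> E" "x \<in> dominance_region f \<alpha>"
proof -
  let ?A = "Poly_Mapping.keys f"
  let ?c = "\<lambda>\<beta>. real_of_ereal (pval (Poly_Mapping.lookup f \<beta>))"
  let ?H = "\<lambda>(\<alpha>, \<beta>). {x. (exponent_point \<beta> - exponent_point \<alpha>) \<bullet> x = ?c \<beta> - ?c \<alpha>}"
  let ?P = "{(\<alpha>, \<beta>). \<alpha> \<in> ?A \<and> \<beta> \<in> ?A \<and> \<alpha> \<noteq> \<beta>}"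
  have "finite ?P" by (rule finite_subset[of _ "?A \<times> ?A"]) auto
  \<comment> \<open>Distinct exponents give a nonzero normal vector, so \<open>?H p\<close> is a
    genuine hyperplane.\<close>
  moreover have "negligible (?H p)" if "p \<in> ?P" for p
    using that
    by (auto simp: inj_eq[OF inj_exponent_point] intro!: negligible_hyperplane)
  ultimately have "negligible (\<Union>(?H ` ?P))" by (intro negligible_Union) auto
  then have "\<not> E \<subseteq> \<Union>(?H ` ?P)"
    using assms(2,3) negligible_subset open_not_negligible by blast
  then obtain x where x: "x \<in> E" "x \<notin> \<Union>(?H ` ?P)" by blast
  let ?g = "\<lambda>\<beta>. exponent_point \<beta> \<bullet> x - ?c \<beta>"
  have "?A \<noteq> {}" using assms(1) by simp
  then have "Max (?g ` ?A) \<in> ?g ` ?A" by (intro Max_in) auto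
  then obtain \<alpha> where \<alpha>: "\<alpha> \<in> ?A" "?g \<alpha> = Max (?g ` ?A)" by auto
  have "x \<in> dominance_region f \<alpha>"
    unfolding dominance_region_def
  proof (intro INT_I CollectI)
    fix \<beta> assume \<beta>: "\<beta> \<in> ?A - {\<alpha>}"
    then have "?g \<beta> \<le> ?g \<alpha>" unfolding \<alpha>(2) by (intro Max_ge) auto
    moreover have "x \<notin> ?H (\<alpha>, \<beta>)" using x(2) \<alpha>(1) \<beta> by blast
    ultimately show "(exponent_point \<beta> - exponent_point \<alpha>) \<bullet> x < ?c \<beta> - ?c \<alpha>"
      by (simp add: inner_diff_left)
  qed
  then show thesis using that \<alpha>(1) x(1) by blast
qed

text \<open>For an exponent \<alpha> of f this is the outer normal cone of the Newton polytope,
  tested on exponents only.\<close>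

definition normal_cone ::
    "('n::finite, 'r::zero) mpolynomial \<Rightarrow> ('n \<Rightarrow>\<^sub>0 nat) \<Rightarrow> (real ^ 'n) set" where
  "normal_cone f \<alpha> = {w. \<forall>\<beta>\<in>Poly_Mapping.keys f. (exponent_point \<beta> - exponent_point \<alpha>) \<bullet> w \<le> 0}"

lemma cone_normal_cone: "cone (normal_cone f \<alpha>)"
  by (auto simp: cone_def normal_cone_def mult_nonneg_nonpos)

lemma convex_normal_cone: "convex (normal_cone f \<alpha>)"
proof -
  have "normal_cone f \<alpha>
      = (\<Inter>\<beta>\<in>Poly_Mapping.keys f. {w. (exponent_point \<beta> - exponent_point \<alpha>) \<bullet> w \<le> 0})"
    by (auto simp: normal_cone_def)
  then show ?thesis by (simp add: convex_INT convex_halfspace_le)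
qed

text \<open>A linear functional exposing the vertex is strictly smaller at all other exponents;
  strictness against finitely many exponents is an open condition, so the functional is interior to
  the cone.\<close>

lemma aff_dim_normal_cone_vertex:
  fixes f :: "('n::finite, 'r::zero) mpolynomial"
  assumes "exponent_point \<alpha> extreme_point_of newton_polytope f"
  shows "aff_dim (normal_cone f \<alpha>) = int CARD('n)"
proof -
  let ?A = "Poly_Mapping.keys f"
  have "polyhedron (newton_polytope f)"
    unfolding newton_polytope_def by (simp add: polyhedron_convex_hull)
  moreover have "{exponent_point \<alpha>} face_of newton_polytope f"
    using assms by (simp add: face_of_singleton)
  \<comment> \<open>Extreme points of a general convex set need not be exposed; those of a
    polyhedron are.\<close>
  ultimately have "{exponent_point \<alpha>} exposed_face_of newton_polytope f"
    by (simp add: exposed_face_of_polyhedron)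
  then obtain w b where wb: "newton_polytope f \<subseteq> {x. w \<bullet> x \<le> b}"
      "{exponent_point \<alpha>} = newton_polytope f \<inter> {x. w \<bullet> x = b}"
    by (auto simp: exposed_face_of_def)
  \<comment> \<open>The index \<alpha> is left out because its normal vector is 0, which would make
    the strict inequality unsatisfiable.\<close>
  let ?U = "\<Inter>\<beta>\<in>?A - {\<alpha>}. {w. (exponent_point \<beta> - exponent_point \<alpha>) \<bullet> w < 0}"
  have "w \<in> ?U"
  proof (intro INT_I CollectI)
    fix \<beta> assume \<beta>: "\<beta> \<in> ?A - {\<alpha>}"
    then have "exponent_point \<beta> \<in> newton_polytope f"
      by (auto simp: newton_polytope_def intro: hull_inc)
    moreover have "exponent_point \<beta> \<noteq> exponent_point \<alpha>"
      using \<beta> by (simp add: inj_eq[OF inj_exponent_point])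
    ultimately have "w \<bullet> exponent_point \<beta> \<le> b" "w \<bullet> exponent_point \<beta> \<noteq> b"
      using wb by auto
    moreover have "w \<bullet> exponent_point \<alpha> = b" using wb(2) by auto
    ultimately show "(exponent_point \<beta> - exponent_point \<alpha>) \<bullet> w < 0"
      by (simp add: inner_diff_right inner_commute)
  qed
  moreover have "open ?U" by (intro open_INT ballI open_halfspace_lt) auto
  moreover have "?U \<subseteq> normal_cone f \<alpha>"
    by (force simp: normal_cone_def)
  ultimately have "interior (normal_cone f \<alpha>) \<noteq> {}"
    using interior_maximal by blast
  then show ?thesis by (simp add: aff_dim_nonempty_interior)
qed

lemma dominance_region_translate_normal_cone:
  assumes "x \<in> dominance_region f \<alpha>"
  shows "(+) x ` normal_cone f \<alpha> \<subseteq> dominance_region f \<alpha>"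
proof (clarsimp simp: dominance_region_def)
  fix w \<beta> assume w: "w \<in> normal_cone f \<alpha>" and \<beta>: "\<beta> \<in> Poly_Mapping.keys f" "\<beta> \<noteq> \<alpha>"
  then have "(exponent_point \<beta> - exponent_point \<alpha>) \<bullet> w \<le> 0"
    by (simp add: normal_cone_def)
  moreover have "(exponent_point \<beta> - exponent_point \<alpha>) \<bullet> x
      < real_of_ereal (pval (Poly_Mapping.lookup f \<beta>))
        - real_of_ereal (pval (Poly_Mapping.lookup f \<alpha>))"
    using assms \<beta> by (auto simp: dominance_region_def)
  ultimately show "(exponent_point \<beta> - exponent_point \<alpha>) \<bullet> (x + w)
      < real_of_ereal (pval (Poly_Mapping.lookup f \<beta>))
        - real_of_ereal (pval (Poly_Mapping.lookup f \<alpha>))"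
    by (simp add: inner_add_right)
qed

theorem mainTheorem3:
  fixes f :: "('n::finite, 'k::field puiseux) mpolynomial"
  assumes "f \<noteq> 0"
    and "maximally_sparse f"
  shows "solid (amoeba (torus_zeros f))"
  unfolding solid_def
proof
  fix E assume E: "E \<in> components (- amoeba (torus_zeros f))"
  have "open (- amoeba (torus_zeros f))" by (auto simp: amoeba_def)
  then have "open E" "E \<noteq> {}"
    using E open_components in_components_nonempty by auto
  then obtain \<alpha> x where \<alpha>: "\<alpha> \<in> Poly_Mapping.keys f" and x: "x \<in> E" "x \<in> dominance_region f \<alpha>"
    using open_meets_dominance_region[OF assms(1)] by metis
  \<comment> \<open>A connected subset of the complement that meets a component lies inside
    it.\<close>
  have "dominance_region f \<alpha> \<subseteq> E"
  proof (rule components_maximal[OF E])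
    show "connected (dominance_region f \<alpha>)"
      by (intro convex_connected convex_dominance_region)
    show "dominance_region f \<alpha> \<subseteq> - amoeba (torus_zeros f)"
      using dominance_region_disjoint_amoeba[OF \<alpha>] by blast
    show "E \<inter> dominance_region f \<alpha> \<noteq> {}" using x by blast
  qed
  then have "(+) x ` normal_cone f \<alpha> \<subseteq> E"
    using dominance_region_translate_normal_cone[OF x(2)] by blast
  \<comment> \<open>Maximal sparsity enters here: whichever monomial dominates at x, its exponent is
    a vertex.\<close>
  moreover have "aff_dim (normal_cone f \<alpha>) = int CARD('n)"
    using assms(2) \<alpha> by (auto simp: maximally_sparse_def intro: aff_dim_normal_cone_vertex)
  ultimately show "full_dim_recession_cone E"
    unfolding full_dim_recession_cone_def using cone_normal_cone convex_normal_cone by blast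
qed

end
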